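(* For every integer $n\ge0$, $$V_n=\sum_{k=0}^n\binom{n}{k}\binom{n+k}{k}(-16)^{n-k}G_k.$$
   Context: For $n\ge0$, $G_n=\sum_{k=0}^n \binom{2k}{k}^2\binom{2n-2k}{n-k}4^{n-k}$ and $V_n=\sum_{k=0}^n\binom{2k}{k}^2\binom{2n-2k}{n-k}^2$. *)

theory Defs
  imports Complex_Main
begin

definition G :: "nat \<Rightarrow> int" where
  "G n = (\<Sum>k=0..n. int (((2 * k) choose k)\<^sup>2 * ((2 * n - 2 * k) choose (n - k)) * 4 ^ (n - k)))"

definition V :: "nat \<Rightarrow> int" where
  "V n = (\<Sum>k=0..n. int (((2 * k) choose k)\<^sup>2 * ((2 * n - 2 * k) choose (n - k))\<^sup>2))"

end

theory Submission
  imports Defs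
begin

text \<open>
  Both sides satisfy
  \<open>(n+2)\<^sup>3 u(n+2) = 8(2n+3)(2n\<^sup>2+6n+5) u(n+1) - 256(n+1)\<^sup>3 u(n)\<close>. For \<open>V\<close> this comes from
  eliminating the higher moments \<open>\<Sum>i. i\<^sup>p a(i) a(n-i)\<close>, where \<open>a(i)\<close> is the square of the central
  binomial coefficient; the same elimination gives
  \<open>(k+1)\<^sup>2 G(k+1) = (32k\<^sup>2+32k+12) G(k) - 256k\<^sup>2 G(k-1)\<close>. For the right-hand side with kernel
  \<open>t(n,k) = C(n,k) C(n+k,k) (-16)^(n-k)\<close>, applying the operator in \<open>n\<close> to \<open>t\<close> equals \<open>2(2n+3)\<close> times
  the adjoint, in \<open>k\<close>, of the operator annihilating \<open>G\<close>, applied to \<open>t(n+1,k)\<close>; summation by parts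
  then moves that operator onto \<open>G\<close>.
\<close>

section \<open>Weighted moments of a convolution\<close>

definition moment :: "(nat \<Rightarrow> real) \<Rightarrow> (nat \<Rightarrow> real) \<Rightarrow> nat \<Rightarrow> nat \<Rightarrow> real" where
  "moment x y p n = (\<Sum>i\<le>n. real i ^ p * (x i * y (n - i)))"

text \<open>The weight \<open>i ^ (p + 2)\<close> kills the term \<open>i = 0\<close>; after the
  index shift, two of its powers are exactly what the recurrence of \<open>x\<close>
  consumes.\<close>

lemma moment_shift_left:
  assumes "\<And>i. (real i + 1)\<^sup>2 * x (Suc i) = s i * x i"
  shows "moment x y (p + 2) (Suc n) = (\<Sum>i\<le>n. s i * (real i + 1) ^ p * (x i * y (n - i)))"
proof -
  have "moment x y (p + 2) (Suc n)
      = (\<Sum>i\<le>n. (real i + 1) ^ (p + 2) * (x (Suc i) * y (n - i)))"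
    unfolding moment_def by (subst sum.atMost_Suc_shift) (simp add: add.commute)
  also have "\<dots> = (\<Sum>i\<le>n. s i * (real i + 1) ^ p * (x i * y (n - i)))"
  proof (rule sum.cong[OF refl])
    fix i
    have "(real i + 1) ^ (p + 2) * (x (Suc i) * y (n - i))
        = ((real i + 1)\<^sup>2 * x (Suc i)) * (real i + 1) ^ p * y (n - i)"
      by (simp add: power_add power2_eq_square)
    then show "(real i + 1) ^ (p + 2) * (x (Suc i) * y (n - i))
        = s i * (real i + 1) ^ p * (x i * y (n - i))"
      by (simp add: assms)
  qed
  finally show ?thesis .
qed

text \<open>The left-hand side weights each term by \<open>n + 1 - i\<close>, which kills
  \<open>i = n + 1\<close> and feeds the recurrence of \<open>y\<close> at index
  \<open>n - i\<close>.\<close>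

lemma moment_shift_right:
  assumes "\<And>j. (real j + 1) * y (Suc j) = s j * y j"
  shows "(real n + 1) * moment x y p (Suc n) - moment x y (Suc p) (Suc n)
    = (\<Sum>i\<le>n. s (n - i) * real i ^ p * (x i * y (n - i)))"
proof -
  have "(real n + 1) * moment x y p (Suc n) - moment x y (Suc p) (Suc n)
      = (\<Sum>i\<le>Suc n. (real n + 1 - real i) * real i ^ p * (x i * y (Suc n - i)))"
    unfolding moment_def sum_distrib_left sum_subtractf[symmetric]
    by (rule sum.cong) (simp_all add: algebra_simps)
  also have "\<dots> = (\<Sum>i\<le>n. (real n + 1 - real i) * real i ^ p * (x i * y (Suc n - i)))"
    by simp
  also have "\<dots> = (\<Sum>i\<le>n. s (n - i) * real i ^ p * (x i * y (n - i)))"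
  proof (rule sum.cong[OF refl])
    fix i assume "i \<in> {..n}"
    then have i: "i \<le> n" by simp
    have "(real n + 1 - real i) * y (Suc n - i) = s (n - i) * y (n - i)"
      using assms[of "n - i"] i by (simp add: Suc_diff_le of_nat_diff algebra_simps)
    then show "(real n + 1 - real i) * real i ^ p * (x i * y (Suc n - i))
        = s (n - i) * real i ^ p * (x i * y (n - i))"
      by (metis (no_types, lifting) mult.assoc mult.left_commute)
  qed
  finally show ?thesis .
qed

lemma moment_reflect: "moment x x p n = (\<Sum>i\<le>n. (real n - real i) ^ p * (x i * x (n - i)))"
  unfolding moment_def
  by (rule sum.reindex_bij_witness[where i = "\<lambda>i. n - i" and j = "\<lambda>i. n - i"])
    (auto simp: of_nat_diff)

section \<open>Central binomial coefficients\<close>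

definition cbin :: "nat \<Rightarrow> real" where
  "cbin i = real ((2 * i) choose i)"

lemma cbin_Suc: "(real i + 1) * cbin (Suc i) = 2 * (2 * real i + 1) * cbin i"
proof -
  have cbin: "cbin j = fact (2 * j) / (fact j * fact j)" for j
    unfolding cbin_def by (subst binomial_fact) simp_all
  show ?thesis
    unfolding cbin by (simp add: divide_simps) (simp add: algebra_simps)
qed

lemma cbin_sq_Suc: "(real i + 1)\<^sup>2 * (cbin (Suc i))\<^sup>2 = 4 * (2 * real i + 1)\<^sup>2 * (cbin i)\<^sup>2"
  using arg_cong[OF cbin_Suc[of i], of "\<lambda>z. z\<^sup>2"]
  by (simp only: power_mult_distrib) simp

lemma cbin_pow4_Suc:
  "(real i + 1) * (cbin (Suc i) * 4 ^ Suc i) = 8 * (2 * real i + 1) * (cbin i * 4 ^ i)"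
  using arg_cong[OF cbin_Suc[of i], of "\<lambda>z. 4 ^ Suc i * z"] by (simp add: algebra_simps)

lemma V_moment: "of_int (V n) = moment (\<lambda>i. (cbin i)\<^sup>2) (\<lambda>i. (cbin i)\<^sup>2) 0 n"
  unfolding V_def moment_def cbin_def
  by (simp add: atLeast0AtMost diff_mult_distrib2)

lemma G_moment: "of_int (G n) = moment (\<lambda>i. (cbin i)\<^sup>2) (\<lambda>i. cbin i * 4 ^ i) 0 n"
  unfolding G_def moment_def cbin_def
  by (simp add: atLeast0AtMost diff_mult_distrib2 mult.assoc)

section \<open>Recurrences for \<open>G\<close> and \<open>V\<close>\<close>

lemma G_recurrence:
  "(real n + 2)\<^sup>2 * of_int (G (n + 2))
    = (32 * (real n + 1)\<^sup>2 + 32 * (real n + 1) + 12) * of_int (G (n + 1))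
      - 256 * (real n + 1)\<^sup>2 * of_int (G n)"
  and G_1_eq: "of_int (G 1) = 12 * (of_int (G 0) :: real)"
proof -
  define M where "M = moment (\<lambda>i. (cbin i)\<^sup>2) (\<lambda>i. cbin i * 4 ^ i)"
  have left: "M 2 (Suc m) = 4 * (4 * M 2 m + 4 * M 1 m + M 0 m)" for m
  proof -
    have "M (0 + 2) (Suc m) = 4 * (4 * M 2 m + 4 * M 1 m + M 0 m)"
      unfolding M_def
      apply (subst moment_shift_left[OF cbin_sq_Suc])
      unfolding moment_def sum_distrib_left sum.distrib[symmetric]
      by (rule sum.cong) (simp_all add: power2_eq_square power3_eq_cube algebra_simps)
    then show ?thesis by (simp only: add_0)
  qed
  have right: "(real m + 1) * M p (Suc m) - M (Suc p) (Suc m)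
      = 8 * ((2 * real m + 1) * M p m - 2 * M (Suc p) m)" for p m
    unfolding M_def
    apply (subst moment_shift_right[OF cbin_pow4_Suc])
    unfolding moment_def sum_distrib_left sum_subtractf[symmetric]
    by (rule sum.cong) (simp_all add: of_nat_diff algebra_simps)
  \<comment> \<open>Adding \<open>left\<close> to \<open>right\<close> with \<open>p = 1\<close>
    cancels the second moments: they occur with coefficients 16 and -16.\<close>
  have M1_Suc: "(real m + 1) * M 1 (Suc m) = (16 * real m + 24) * M 1 m + 4 * M 0 m" for m
    using right[of m 1] left[of m] by (simp add: numeral_2_eq_2 algebra_simps)
  have M1: "8 * M 1 m = (real m + 1)\<^sup>2 * M 0 (Suc m)
      - (16 * (real m)\<^sup>2 + 24 * real m + 12) * M 0 m" for m
  proof -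
    have "(real m + 1) * M 0 (Suc m) - M 1 (Suc m)
        = 8 * ((2 * real m + 1) * M 0 m - 2 * M 1 m)"
      using right[of m 0] by simp
    with M1_Suc[of m] show ?thesis by algebra
  qed
  have "(real n + 2)\<^sup>2 * M 0 (Suc (Suc n))
    = (32 * (real n + 1)\<^sup>2 + 32 * (real n + 1) + 12) * M 0 (Suc n)
      - 256 * (real n + 1)\<^sup>2 * M 0 n"
  proof -
    have "8 * M 1 (Suc n) = (real n + 2)\<^sup>2 * M 0 (Suc (Suc n))
      - (16 * (real n + 1)\<^sup>2 + 24 * (real n + 1) + 12) * M 0 (Suc n)"
      using M1[of "Suc n"] by (simp add: add.commute)
    moreover have "(real n + 1) * (8 * M 1 (Suc n)) = (16 * real n + 24) * (8 * M 1 n) + 32 * M 0 n"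
      using M1_Suc[of n] by (simp add: algebra_simps)
    moreover note M1[of n]
    \<comment> \<open>Putting \<open>M1\<close> at \<open>n\<close> and \<open>n + 1\<close> into
      \<open>M1_Suc\<close> leaves only zeroth moments. The coefficient of \<open>M 0 n\<close>
      becomes \<open>256 * (n + 1) ^ 3\<close>, so a factor \<open>n + 1\<close> cancels.\<close>
    ultimately have "(real n + 1) * ((real n + 2)\<^sup>2 * M 0 (Suc (Suc n)))
      = (real n + 1) * ((32 * (real n + 1)\<^sup>2 + 32 * (real n + 1) + 12) * M 0 (Suc n)
      - 256 * (real n + 1)\<^sup>2 * M 0 n)"
      by algebra
    then show ?thesis by (simp add: mult_left_cancel)
  qed
  then show "(real n + 2)\<^sup>2 * of_int (G (n + 2))
    = (32 * (real n + 1)\<^sup>2 + 32 * (real n + 1) + 12) * of_int (G (n + 1))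
      - 256 * (real n + 1)\<^sup>2 * of_int (G n)"
    by (simp add: G_moment M_def)
  \<comment> \<open>This is the recurrence one index lower, where the third term has coefficient 0;
    it starts the summation by parts.\<close>
  show "of_int (G 1) = 12 * (of_int (G 0) :: real)"
    by (simp add: G_def)
qed

lemma V_recurrence:
  "(real n + 2) ^ 3 * of_int (V (n + 2))
    = 8 * (2 * real n + 3) * (2 * (real n)\<^sup>2 + 6 * real n + 5) * of_int (V (n + 1))
      - 256 * (real n + 1) ^ 3 * of_int (V n)"
proof -
  define x where "x = (\<lambda>i. (cbin i)\<^sup>2)"
  define M where "M = moment x x"
  have x_Suc: "(real i + 1)\<^sup>2 * x (Suc i) = 4 * (2 * real i + 1)\<^sup>2 * x i" for i
    unfolding x_def by (rule cbin_sq_Suc)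
  have left0: "M 2 (Suc m) = 4 * (4 * M 2 m + 4 * M 1 m + M 0 m)" for m
  proof -
    have "M (0 + 2) (Suc m) = 4 * (4 * M 2 m + 4 * M 1 m + M 0 m)"
      unfolding M_def
      apply (subst moment_shift_left[OF x_Suc])
      unfolding moment_def sum_distrib_left sum.distrib[symmetric]
      by (rule sum.cong) (simp_all add: power2_eq_square power3_eq_cube algebra_simps)
    then show ?thesis by (simp only: add_0)
  qed
  have left1: "M 3 (Suc m) = 4 * (4 * M 3 m + 8 * M 2 m + 5 * M 1 m + M 0 m)" for m
  proof -
    have "M (1 + 2) (Suc m) = 4 * (4 * M 3 m + 8 * M 2 m + 5 * M 1 m + M 0 m)"
      unfolding M_def
      apply (subst moment_shift_left[OF x_Suc])
      unfolding moment_def sum_distrib_left sum.distrib[symmetric]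
      by (rule sum.cong) (simp_all add: power2_eq_square power3_eq_cube algebra_simps)
    then show ?thesis by (simp only: one_plus_numeral semiring_norm)
  qed
  \<comment> \<open>Both factors coincide, so reflection applies. For odd \<open>p\<close> the top
    moment returns with a minus sign, which reduces \<open>M 1\<close> and \<open>M 3\<close> to
    lower moments.\<close>
  have M1: "2 * M 1 m = real m * M 0 m" for m
  proof -
    have "M 1 m = real m * M 0 m - M 1 m"
      unfolding M_def
      apply (subst moment_reflect)
      unfolding moment_def sum_distrib_left sum_subtractf[symmetric]
      by (rule sum.cong) (simp_all add: algebra_simps)
    then show ?thesis by simp
  qed
  have M3: "2 * M 3 m = real m ^ 3 * M 0 m - 3 * (real m)\<^sup>2 * M 1 m + 3 * real m * M 2 m" for m
  proof -
    have "M 3 m = real m ^ 3 * M 0 m - 3 * (real m)\<^sup>2 * M 1 m + 3 * real m * M 2 m - M 3 m"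
      unfolding M_def
      apply (subst moment_reflect)
      unfolding moment_def sum_distrib_left sum_subtractf[symmetric] sum.distrib[symmetric]
      by (rule sum.cong) (simp_all add: power2_eq_square power3_eq_cube algebra_simps)
    then show ?thesis by simp
  qed
  \<comment> \<open>The reflected cubic relation at \<open>m + 1\<close> is pulled back to
    \<open>m\<close> by \<open>left0\<close> and \<open>left1\<close>; only \<open>M 2 m\<close> and
    zeroth moments survive.\<close>
  have M2: "32 * M 2 m = - ((real m + 1) ^ 3 * M 0 (Suc m))
      + (16 * (real m) ^ 3 + 48 * (real m)\<^sup>2 + 32 * real m + 8) * M 0 m" for m
  proof -
    have "2 * M 1 (Suc m) = (real m + 1) * M 0 (Suc m)"
      "2 * M 3 (Suc m) = (real m + 1) ^ 3 * M 0 (Suc m)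
        - 3 * (real m + 1)\<^sup>2 * M 1 (Suc m) + 3 * (real m + 1) * M 2 (Suc m)"
      using M1[of "Suc m"] M3[of "Suc m"] by (simp_all add: add.commute)
    with left0[of m] left1[of m] M1[of m] M3[of m] show ?thesis by algebra
  qed
  have "(real n + 2) ^ 3 * M 0 (Suc (Suc n))
    = 8 * (2 * real n + 3) * (2 * (real n)\<^sup>2 + 6 * real n + 5) * M 0 (Suc n)
      - 256 * (real n + 1) ^ 3 * M 0 n"
    \<comment> \<open>\<open>left0\<close> links the second moments at \<open>n\<close> and
      \<open>n + 1\<close>, and \<open>M2\<close> turns both into zeroth moments.\<close>
    using M2[of "Suc n"] M2[of n] left0[of n] M1[of n]
    apply (simp add: add.commute)
    by algebra
  then show ?thesis by (simp add: V_moment M_def x_def)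
qed

section \<open>The kernel and its operator identity\<close>

definition kern :: "nat \<Rightarrow> nat \<Rightarrow> real" where
  "kern n k = real (n choose k) * real ((n + k) choose k) * (- 16) ^ (n - k)"

lemma kern_eq_0: "n < k \<Longrightarrow> kern n k = 0"
  by (simp add: kern_def)

text \<open>The factor \<open>fact (k + d)\<close> cancels between the two binomials, leaving a
  trinomial coefficient. Writing \<open>n = k + d\<close> avoids truncated subtraction.\<close>

lemma kern_add: "kern (k + d) k = fact (2 * k + d) / ((fact k)\<^sup>2 * fact d) * (- 16) ^ d"
proof -
  have "real ((k + d) choose k) = fact (k + d) / (fact k * fact d)"
    "real ((k + d + k) choose k) = fact (2 * k + d) / (fact k * fact (k + d))"
    by (subst binomial_fact; simp add: ac_simps mult_2 mult_2_right)+
  then show ?thesis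
    by (simp add: kern_def power2_eq_square)
qed

text \<open>Expressing all five kernel values as polynomial multiples of one quantity \<open>B\<close> makes
  \<open>kern_operator\<close> a polynomial identity valid also for \<open>k\<close> near or beyond \<open>n\<close>, where the ratios
  of the kernel values degenerate.\<close>

lemma kern_base:
  obtains B where
    "kern n k = (real n + 2 - k) * (real n + 1 - k) * B"
    "kern (Suc n) k = - 16 * (real n + 1 + k) * (real n + 2 - k) * B"
    "kern (Suc (Suc n)) k = 256 * (real n + 2 + k) * (real n + 1 + k) * B"
    "(real k)\<^sup>2 * kern (Suc n) (k - 1) = 256 * (real k) ^ 4 * B"
    "(real k + 1)\<^sup>2 * kern (Suc n) (Suc k)
      = (real n + 1 - k) * (real n + 2 + k) * (real n + 1 + k) * (real n + 2 - k) * B"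
proof (cases "k \<le> n + 2")
  case False
  then show ?thesis
    by (intro that[of 0]) (simp_all add: kern_eq_0)
next
  case True
  then obtain e where e: "n + 2 = k + e"
    using le_Suc_ex by blast
  \<comment> \<open>By \<open>kern_add\<close>, this is \<open>kern (n + 2) k\<close> divided by
    \<open>256 * (n + 2 + k) * (n + 1 + k)\<close>.\<close>
  define B where "B = fact (n + k) / ((fact k)\<^sup>2 * fact e) * (- 16) ^ e / (256 :: real)"
  have low: "(real k)\<^sup>2 * kern (Suc n) (k - 1) = 256 * (real k) ^ 4 * B"
  proof (cases k)
    case 0
    then show ?thesis by simp
  next
    case j: (Suc j)
    have n: "Suc n = j + e" "n + k = 2 * j + e" using e j by simp_all
    show ?thesis
      unfolding n(1) B_def n(2) by (simp add: j kern_add power2_eq_square power4_eq_xxxx divide_simps)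
  qed
  have fact1: "fact (Suc (n + k)) = (real n + 1 + k) * fact (n + k)"
    by (simp add: add.commute)
  have fact2: "fact (Suc (Suc (n + k))) = (real n + 2 + k) * (real n + 1 + k) * fact (n + k)"
    unfolding fact_Suc[of "Suc (n + k)"] fact1 by (simp add: algebra_simps)
  \<comment> \<open>For \<open>e < 2\<close> some kernel values lie beyond the diagonal and vanish,
    as do their polynomial factors; from \<open>e = 2\<close> on, \<open>kern_add\<close> covers all
    of them.\<close>
  consider "e = 0" | "e = 1" | d where "e = Suc (Suc d)"
    by (metis One_nat_def not0_implies_Suc)
  then show ?thesis
  proof cases
    case 1
    then have k: "k = n + 2" using e by simp
    then have ix: "Suc (Suc n) = k + 0" "2 * k + 0 = Suc (Suc (n + k))" by simp_all
    have "kern (Suc (Suc n)) k = 256 * (real n + 2 + k) * (real n + 1 + k) * B"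
      unfolding ix(1) kern_add ix(2) fact2 B_def 1 by (simp add: field_simps)
    with low show ?thesis
      by (intro that[of B]) (simp_all add: k kern_eq_0)
  next
    case 2
    then have k: "k = n + 1" using e by simp
    then have ix: "Suc n = k + 0" "2 * k + 0 = Suc (n + k)"
      "Suc (Suc n) = k + 1" "2 * k + 1 = Suc (Suc (n + k))" and diff: "real n + 2 - k = 1"
      by simp_all
    have "kern (Suc n) k = - 16 * (real n + 1 + k) * (real n + 2 - k) * B"
      unfolding diff ix(1) kern_add ix(2) fact1 B_def 2 by (simp add: field_simps)
    moreover have "kern (Suc (Suc n)) k = 256 * (real n + 2 + k) * (real n + 1 + k) * B"
      unfolding ix(3) kern_add ix(4) fact2 B_def 2 by (simp add: field_simps)
    ultimately show ?thesis
      using low by (intro that[of B]) (simp_all add: k kern_eq_0)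
  next
    case (3 d)
    then have n: "n = k + d" using e by simp
    then have ix: "Suc n = k + Suc d" "Suc (Suc n) = k + Suc (Suc d)" "Suc n = Suc k + d"
      "2 * k + d = n + k" "2 * k + Suc d = Suc (n + k)"
      "2 * k + Suc (Suc d) = Suc (Suc (n + k))" "2 * Suc k + d = Suc (Suc (n + k))"
      and diff: "real n + 2 - k = real d + 2" "real n + 1 - k = real d + 1"
      by simp_all
    have B: "fact (n + k) * (- 16) ^ d = (real d + 2) * (real d + 1) * ((fact k)\<^sup>2 * fact d) * B"
      unfolding B_def 3 by (simp add: divide_simps) (simp add: algebra_simps)
    have "kern n k = (real n + 2 - k) * (real n + 1 - k) * B"
      using kern_add[of k d] B unfolding n[symmetric] ix(4) diff by simp
    moreover have "kern (Suc n) k = - 16 * (real n + 1 + k) * (real n + 2 - k) * B"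
      unfolding diff ix(1) kern_add ix(5) fact1 B_def 3
      by (simp add: divide_simps) (simp add: algebra_simps)
    moreover have "kern (Suc (Suc n)) k = 256 * (real n + 2 + k) * (real n + 1 + k) * B"
      unfolding ix(2) kern_add ix(6) fact2 B_def 3 by (simp add: divide_simps)
    moreover have "(real k + 1)\<^sup>2 * kern (Suc n) (Suc k)
      = (real n + 1 - k) * (real n + 2 + k) * (real n + 1 + k) * (real n + 2 - k) * B"
    proof -
      have "(real k + 1)\<^sup>2 * kern (Suc n) (Suc k)
          = (real n + 2 + k) * (real n + 1 + k) * (fact (n + k) * (- 16) ^ d) / ((fact k)\<^sup>2 * fact d)"
        unfolding ix(3) kern_add ix(7) fact2
        by (simp add: power_mult_distrib divide_simps)
      also have "\<dots> = (real n + 2 + k) * (real n + 1 + k) * ((real d + 2) * (real d + 1) * B)"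
        unfolding B by simp
      finally show ?thesis unfolding diff by (simp only: mult_ac)
    qed
    ultimately show ?thesis
      using low by (intro that[of B])
  qed
qed

lemma kern_operator:
  "(real n + 2) ^ 3 * kern (n + 2) k
     - 8 * (2 * real n + 3) * (2 * (real n)\<^sup>2 + 6 * real n + 5) * kern (n + 1) k
     + 256 * (real n + 1) ^ 3 * kern n k
   = 2 * (2 * real n + 3) * ((real k)\<^sup>2 * kern (n + 1) (k - 1)
       - (32 * (real k)\<^sup>2 + 32 * real k + 12) * kern (n + 1) k
       + 256 * (real k + 1)\<^sup>2 * kern (n + 1) (k + 1))"
proof -
  obtain B where B:
    "kern n k = (real n + 2 - k) * (real n + 1 - k) * B"
    "kern (Suc n) k = - 16 * (real n + 1 + k) * (real n + 2 - k) * B"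
    "kern (Suc (Suc n)) k = 256 * (real n + 2 + k) * (real n + 1 + k) * B"
    "(real k)\<^sup>2 * kern (Suc n) (k - 1) = 256 * (real k) ^ 4 * B"
    "(real k + 1)\<^sup>2 * kern (Suc n) (Suc k)
      = (real n + 1 - k) * (real n + 2 + k) * (real n + 1 + k) * (real n + 2 - k) * B"
    by (rule kern_base)
  show ?thesis
    using B(5)
    unfolding add_2_eq_Suc' Suc_eq_plus1[symmetric] B(1-4)
    by algebra
qed

section \<open>Transfer of the operator to \<open>G\<close>\<close>

text \<open>Collected by values of \<open>w\<close>, the coefficients below \<open>K\<close> vanish
  by the recurrence of \<open>G\<close>. Only the boundary at \<open>K\<close> remains; at
  \<open>k = 0\<close> the factor \<open>k\<^sup>2\<close> removes the truncated
  \<open>w (k - 1)\<close>.\<close>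

lemma sum_by_parts_G:
  "(\<Sum>k\<le>K. of_int (G k) * ((real k)\<^sup>2 * w (k - 1)
       - (32 * (real k)\<^sup>2 + 32 * real k + 12) * w k + 256 * (real k + 1)\<^sup>2 * w (k + 1)))
   = (real K + 1)\<^sup>2 * (256 * of_int (G K) * w (K + 1) - of_int (G (K + 1)) * w K)"
proof (induction K)
  case 0
  show ?case using G_1_eq by (simp add: algebra_simps)
next
  case (Suc K)
  show ?case
    using G_recurrence[of K] by (simp only: sum.atMost_Suc Suc.IH) (simp add: add.commute, algebra)
qed

definition ksum :: "nat \<Rightarrow> real" where
  "ksum n = (\<Sum>k\<le>n. kern n k * of_int (G k))"

text \<open>Zero padding gives the three sums of the recurrence a common range.\<close>

lemma ksum_extend: "n \<le> K \<Longrightarrow> ksum n = (\<Sum>k\<le>K. kern n k * of_int (G k))"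
  unfolding ksum_def by (rule sum.mono_neutral_left) (auto simp: kern_eq_0)

lemma ksum_recurrence:
  "(real n + 2) ^ 3 * ksum (n + 2)
    = 8 * (2 * real n + 3) * (2 * (real n)\<^sup>2 + 6 * real n + 5) * ksum (n + 1)
      - 256 * (real n + 1) ^ 3 * ksum n"
proof -
  let ?a = "(real n + 2) ^ 3"
  let ?b = "8 * (2 * real n + 3) * (2 * (real n)\<^sup>2 + 6 * real n + 5)"
  let ?c = "256 * (real n + 1) ^ 3"
  let ?g = "\<lambda>k. of_int (G k) :: real"
  have "?a * ksum (n + 2) - ?b * ksum (n + 1) + ?c * ksum n
      = (\<Sum>k\<le>n+2. ?g k * (?a * kern (n + 2) k - ?b * kern (n + 1) k + ?c * kern n k))"
    by (simp only: ksum_extend[of _ "n + 2"] le_add1 add_le_cancel_left one_le_numeral order_refl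
        sum_distrib_left sum_subtractf[symmetric] sum.distrib[symmetric])
      (rule sum.cong, simp_all only: algebra_simps)
  also have "\<dots> = 2 * (2 * real n + 3) * (\<Sum>k\<le>n+2. ?g k * ((real k)\<^sup>2 * kern (n + 1) (k - 1)
       - (32 * (real k)\<^sup>2 + 32 * real k + 12) * kern (n + 1) k
       + 256 * (real k + 1)\<^sup>2 * kern (n + 1) (k + 1)))"
    unfolding kern_operator sum_distrib_left by (rule sum.cong) (simp_all only: ac_simps)
  \<comment> \<open>The boundary terms contain \<open>kern (n + 1)\<close> at \<open>n + 2\<close>
    and \<open>n + 3\<close>, both zero.\<close>
  also have "\<dots> = 0"
    by (simp only: sum_by_parts_G) (simp add: kern_eq_0)
  finally show ?thesis by simp
qed

section \<open>Comparison of the two sequences\<close>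

lemma V_eq_ksum: "of_int (V n) = ksum n"
proof (induction n rule: induct_nat_012)
  case 0
  show ?case by (simp add: V_def G_def ksum_def kern_def)
next
  case 1
  show ?case by (simp add: V_def G_def ksum_def kern_def)
next
  case (ge2 n)
  have "(real n + 2) ^ 3 * of_int (V (n + 2)) = (real n + 2) ^ 3 * ksum (n + 2)"
    using V_recurrence[of n] ksum_recurrence[of n] ge2 by simp
  \<comment> \<open>A nonzero leading coefficient lets the recurrence determine the next
    value.\<close>
  moreover have "(real n + 2) ^ 3 \<noteq> 0" by simp
  ultimately show ?case by (simp only: mult_cancel_left add_2_eq_Suc' simp_thms)
qed

theorem theorem3p1:
  fixes n :: nat
  shows "V n = (\<Sum>k=0..n. int (n choose k) * int ((n + k) choose k) * (- 16) ^ (n - k) * G k)"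
proof -
  have "real_of_int (V n)
      = of_int (\<Sum>k=0..n. int (n choose k) * int ((n + k) choose k) * (- 16) ^ (n - k) * G k)"
    by (simp add: V_eq_ksum ksum_def kern_def atLeast0AtMost)
  then show ?thesis by (simp only: of_int_eq_iff)
qed

end
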